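(* Let $l\ge1$, $m\ge2$ and $d\ge2ml$, let $\mathcal{X}=\{0,1\}^d$, and let $\mathcal{H}$ be the set of all conjunctions of $l$ disjunctions over $d$ variables without negations, where each disjunction has exactly $m$ variables and no variable appears in more than one disjunction; so $n=|\mathcal{H}|=\frac{1}{l!}\frac{d!}{(m!)^l(d-lm)!}$. If the problem $(\mathcal{H},\mathcal{X})$ is $k$-neighborly, then $k\ge\sqrt n$.
   Context: A hypothesis is a function $h:\{0,1\}^d\to\{0,1\}$ of the form $h(x)=\bigwedge_{j=1}^l\bigvee_{i\in A_j}x_i$ with $A_1,\dots,A_l\subseteq\{1,\dots,d\}$ pairwise disjoint and $|A_j|=m$ for all $j$. The elements of $\mathcal{X}$ are called tests. For tests $x,x'$ let $\Delta(x,x')=\{h\in\mathcal{H}: h(x)=0 \wedge h(x')=1\}$. The problem is $k$-neighborly if the undirected graph on $\mathcal{X}$ with an edge $(x,x')$ whenever $|\Delta(x,x')\cup\Delta(x',x)|\le k$ is connected. *)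

theory Defs
  imports Complex_Main "HOL-Library.FuncSet" "HOL-Library.Disjoint_Sets"
begin

text \<open>Truth values stand for 0 and 1. Tests and hypotheses are extensional functions, so
  that equality is equality on the cube and cardinalities are the intended ones.\<close>

definition cube :: "nat \<Rightarrow> (nat \<Rightarrow> bool) set" where
  "cube d = {1..d} \<rightarrow>\<^sub>E UNIV"

definition conj_of_disj :: "nat \<Rightarrow> nat \<Rightarrow> (nat \<Rightarrow> nat set) \<Rightarrow> (nat \<Rightarrow> bool) \<Rightarrow> bool" where
  "conj_of_disj d l A = (\<lambda>x\<in>cube d. \<forall>j\<in>{1..l}. \<exists>i\<in>A j. x i)"

text \<open>The elements are Boolean functions, not index families: families that differ only by
  a permutation of the disjunctions give the same element.\<close>

definition hypotheses :: "nat \<Rightarrow> nat \<Rightarrow> nat \<Rightarrow> ((nat \<Rightarrow> bool) \<Rightarrow> bool) set" where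
  "hypotheses d l m =
     {conj_of_disj d l A | A. (\<forall>j\<in>{1..l}. A j \<subseteq> {1..d} \<and> card (A j) = m) \<and>
                              disjoint_family_on A {1..l}}"

definition Delta :: "('x \<Rightarrow> bool) set \<Rightarrow> 'x \<Rightarrow> 'x \<Rightarrow> ('x \<Rightarrow> bool) set" where
  "Delta H x x' = {h \<in> H. \<not> h x \<and> h x'}"

definition neighbor_edges :: "('x \<Rightarrow> bool) set \<Rightarrow> 'x set \<Rightarrow> nat \<Rightarrow> ('x \<times> 'x) set" where
  "neighbor_edges H X k =
     {(x, x'). x \<in> X \<and> x' \<in> X \<and> finite (Delta H x x' \<union> Delta H x' x) \<and>
               card (Delta H x x' \<union> Delta H x' x) \<le> k}"

text \<open>The edge relation is symmetric, so reachability is connectivity of the undirected graph.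
  The finiteness conjunct above only guards against \<open>card\<close> being 0 on infinite sets.\<close>

definition neighborly :: "('x \<Rightarrow> bool) set \<Rightarrow> 'x set \<Rightarrow> nat \<Rightarrow> bool" where
  "neighborly H X k \<longleftrightarrow> (\<forall>x\<in>X. \<forall>y\<in>X. (x, y) \<in> (neighbor_edges H X k)\<^sup>*)"

end

theory Submission
  imports Defs
begin

text \<open>A hypothesis amounts to a packing of \<open>l\<close> disjoint \<open>m\<close>-sets into \<open>{1..d}\<close>, and it is false on
  every test with fewer than \<open>l\<close> ones. A path from the all-zero to the all-one test has an
  edge that leaves the tests with fewer than \<open>l\<close> ones; \<open>k\<close> is then at least the number \<open>q\<close> of
  packings all of whose blocks meet a fixed \<open>l\<close>-set \<open>T\<close>. With \<open>c = d - l - (l - 1) * (m - 1)\<close>,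
  counting gives \<open>n * m ^ l \<le> (d choose l) * q\<close> and \<open>q \<ge> c ^ l\<close>, while
  \<open>d choose l \<le> d ^ l \<le> (m * c) ^ l\<close> since \<open>d \<le> 2 * c\<close>. Together \<open>n \<le> q\<^sup>2\<close>.\<close>

section \<open>Packings of disjoint \<open>m\<close>-sets and their number\<close>

definition packings :: "'a set \<Rightarrow> nat \<Rightarrow> nat \<Rightarrow> 'a set set set" where
  "packings D l m = {F. F \<subseteq> Pow D \<and> card F = l \<and> (\<forall>A\<in>F. card A = m) \<and> disjoint F}"

lemma finite_packings: "finite D \<Longrightarrow> finite (packings D l m)"
  by (rule finite_subset[of _ "Pow (Pow D)"]) (auto simp: packings_def)

lemma finite_packing: "finite D \<Longrightarrow> F \<in> packings D l m \<Longrightarrow> finite F"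
  unfolding packings_def by (auto intro: finite_subset[of F "Pow D"])

lemma packings_0: "finite D \<Longrightarrow> packings D 0 m = {{}}"
  by (auto simp: packings_def disjoint_def dest: finite_subset[of _ "Pow D"])

lemma block_not_in_packing:
  assumes "G \<in> packings (D - A) l m" "A \<noteq> {}"
  shows "A \<notin> G"
  using assms by (auto simp: packings_def)

lemma insert_block_packing:
  assumes "finite D" "A \<subseteq> D" "card A = m" "A \<noteq> {}" "G \<in> packings (D - A) l m"
  shows "insert A G \<in> packings D (Suc l) m"
proof -
  have "card (insert A G) = Suc l"
    using assms finite_packing[OF _ assms(5)] block_not_in_packing[OF assms(5,4)]
    by (simp add: packings_def)
  moreover have "disjoint (insert A G)"
    using assms(5) by (auto simp: packings_def disjoint_def)
  ultimately show ?thesis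
    using assms by (auto simp: packings_def)
qed

lemma remove_block_packing:
  assumes "finite D" "F \<in> packings D (Suc l) m" "A \<in> F"
  shows "F - {A} \<in> packings (D - A) l m"
proof -
  have "card (F - {A}) = l"
    using assms finite_packing[OF assms(1,2)] by (simp add: packings_def)
  moreover have "F - {A} \<subseteq> Pow (D - A)"
    using assms by (fastforce simp: packings_def disjoint_def)
  ultimately show ?thesis
    using assms by (auto simp: packings_def disjoint_def)
qed

text \<open>Double counting of pairs of a packing and one of its blocks.\<close>

lemma card_packings_Suc:
  assumes "finite D" "m > 0"
  shows "Suc l * card (packings D (Suc l) m)
    = (\<Sum>A | A \<subseteq> D \<and> card A = m. card (packings (D - A) l m))"
proof -
  let ?S = "{A. A \<subseteq> D \<and> card A = m}"
  have ne: "A \<noteq> {}" if "A \<in> ?S" for A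
    using that assms by auto
  \<comment> \<open>Only a nonempty block is sure to be missing from a packing of
    \<open>D - A\<close>; this makes deleting \<open>A\<close> undo its insertion.\<close>
  have notin: "A \<notin> G" if "A \<in> ?S" "G \<in> packings (D - A) l m" for A G
    using block_not_in_packing[OF that(2) ne[OF that(1)]] .
  have fS: "finite ?S"
    using assms by simp
  have "bij_betw (\<lambda>(F, A). (A, F - {A})) (SIGMA F:packings D (Suc l) m. F)
      (SIGMA A:?S. packings (D - A) l m)"
  proof (rule bij_betw_byWitness[where f' = "\<lambda>(A, G). (insert A G, A)"])
    show "(\<lambda>(F, A). (A, F - {A})) ` (SIGMA F:packings D (Suc l) m. F)
        \<subseteq> (SIGMA A:?S. packings (D - A) l m)"
      using remove_block_packing[OF assms(1)] by (force simp: packings_def[of D])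
    show "(\<lambda>(A, G). (insert A G, A)) ` (SIGMA A:?S. packings (D - A) l m)
        \<subseteq> (SIGMA F:packings D (Suc l) m. F)"
      using insert_block_packing[OF assms(1)] ne by auto
      show "\<forall>x\<in>SIGMA A:?S. packings (D - A) l m.
        (case case x of (A, G) \<Rightarrow> (insert A G, A) of (F, A) \<Rightarrow> (A, F - {A})) = x"
    proof
      fix x assume "x \<in> (SIGMA A:?S. packings (D - A) l m)"
      then obtain A G where "x = (A, G)" "A \<in> ?S" "G \<in> packings (D - A) l m"
        by blast
      then show "(case case x of (A, G) \<Rightarrow> (insert A G, A) of (F, A) \<Rightarrow> (A, F - {A})) = x"
        using notin[of A G] by simp
    qed
  qed (auto simp: insert_absorb)
  then have "card (SIGMA F:packings D (Suc l) m. F) = card (SIGMA A:?S. packings (D - A) l m)"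
    by (rule bij_betw_same_card)
  moreover have "card (SIGMA F:packings D (Suc l) m. F) = (\<Sum>F\<in>packings D (Suc l) m. card F)"
    using assms finite_packings finite_packing by (intro card_SigmaI) blast+
  moreover have "(\<Sum>F\<in>packings D (Suc l) m. card F) = Suc l * card (packings D (Suc l) m)"
    by (simp add: packings_def)
  moreover have "card (SIGMA A:?S. packings (D - A) l m) = (\<Sum>A\<in>?S. card (packings (D - A) l m))"
    using assms fS by (intro card_SigmaI) (auto simp: finite_packings)
  ultimately show ?thesis
    by simp
qed

text \<open>Each of the \<open>card D choose m\<close> choices of a block leaves
  \<open>card D - m\<close> points, so all summands in \<open>card_packings_Suc\<close> agree and
  the factorials telescope. The product form avoids division in \<open>nat\<close>.\<close>

lemma card_packings:
  assumes "finite D" "m > 0" "l * m \<le> card D"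
  shows "card (packings D l m) * (fact l * fact m ^ l * fact (card D - l * m)) = fact (card D)"
  using assms(1,3)
proof (induction l arbitrary: D)
  case 0
  then show ?case by (simp add: packings_0)
next
  case (Suc l)
  let ?S = "{A. A \<subseteq> D \<and> card A = m}"
  have IH: "card (packings (D - A) l m) * (fact l * fact m ^ l * fact (card D - Suc l * m))
      = fact (card D - m)" if "A \<in> ?S" for A
  proof -
    have "card (D - A) = card D - m"
      using that Suc.prems finite_subset by (auto intro: card_Diff_subset)
    with Suc.IH[of "D - A"] Suc.prems show ?thesis
      by (simp add: algebra_simps)
  qed
  have "card (packings D (Suc l) m) * (fact (Suc l) * fact m ^ Suc l * fact (card D - Suc l * m))
      = (Suc l * card (packings D (Suc l) m))
        * (fact l * fact m ^ l * fact (card D - Suc l * m)) * fact m"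
    by (simp add: algebra_simps)
  also have "\<dots> = (\<Sum>A\<in>?S. fact (card D - m)) * fact m"
    unfolding card_packings_Suc[OF Suc.prems(1) assms(2)] sum_distrib_right
    by (intro sum.cong arg_cong[where f = "\<lambda>a. a * fact m"] IH refl)
  also have "\<dots> = fact (card D)"
    using Suc.prems binomial_fact_lemma[of m "card D"]
    by (simp add: n_subsets algebra_simps)
  finally show ?case .
qed

section \<open>Packings whose blocks all meet a given set\<close>

text \<open>For finite \<open>T\<close> there are as many disjoint blocks as points of
  \<open>T\<close>, so each block contains exactly one of these points.\<close>

definition transversal_packings :: "'a set \<Rightarrow> 'a set \<Rightarrow> nat \<Rightarrow> 'a set set set" where
  "transversal_packings D T m = {F \<in> packings D (card T) m. \<forall>A\<in>F. A \<inter> T \<noteq> {}}"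

lemma finite_transversal_packings: "finite D \<Longrightarrow> finite (transversal_packings D T m)"
  by (simp add: transversal_packings_def finite_packings)

text \<open>In the induction step \<open>insert t B\<close> is the block of the new point \<open>t\<close>.\<close>

lemma card_transversal_packings_ge:
  assumes "finite T" "finite D" "T \<subseteq> D" "m > 0" "card T * m \<le> card D"
  shows "fact (card D - card T)
    \<le> card (transversal_packings D T m) * (fact (m - 1) ^ card T * fact (card D - card T * m))"
  using assms(1,2,3,5)
proof (induction T arbitrary: D rule: finite_induct)
  case empty
  then show ?case by (simp add: transversal_packings_def packings_0)
next
  case (insert t T)
  let ?l = "card T"
  let ?S = "{B. B \<subseteq> D - insert t T \<and> card B = m - 1}"
  let ?Q = "\<lambda>B. transversal_packings (D - insert t B) T m"
  let ?g = "\<lambda>(B, G). insert (insert t B) G"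
  let ?K = "fact (m - 1) ^ ?l * fact (card D - Suc ?l * m) :: nat"
  have fS: "finite ?S"
    using insert.prems by simp
  have cardD': "card (D - insert t B) = card D - m" and card_block: "card (insert t B) = m"
    if "B \<in> ?S" for B
  proof -
    have fB: "finite B" "t \<notin> B"
      using that insert.prems finite_subset by blast+
    then show "card (insert t B) = m"
      using that assms(4) by simp
    with fB show "card (D - insert t B) = card D - m"
      using that insert.prems by (subst card_Diff_subset) auto
  qed
  have IH: "fact (card D - m - ?l) \<le> card (?Q B) * ?K" if "B \<in> ?S" for B
  proof -
    have "finite (D - insert t B)" "T \<subseteq> D - insert t B" "?l * m \<le> card (D - insert t B)"
      using that insert.prems insert.hyps cardD'[OF that] by auto
    from insert.IH[OF this] show ?thesis
      by (simp add: cardD'[OF that] algebra_simps)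
  qed
  have sub: "?g ` (SIGMA B:?S. ?Q B) \<subseteq> transversal_packings D (insert t T) m"
  proof clarify
    fix B G assume B: "B \<subseteq> D - insert t T" "card B = m - 1" and G: "G \<in> ?Q B"
    have "insert (insert t B) G \<in> packings D (Suc ?l) m"
      using B G insert.prems card_block[of B]
      by (intro insert_block_packing) (auto simp: transversal_packings_def)
    then show "insert (insert t B) G \<in> transversal_packings D (insert t T) m"
      using G insert.hyps by (auto simp: transversal_packings_def)
  qed
  have inj: "inj_on ?g (SIGMA B:?S. ?Q B)"
  \<comment> \<open>The blocks of \<open>G\<close> avoid \<open>t\<close>, so
    \<open>insert t B\<close> is the only block through \<open>t\<close>; the union merely extracts
    it from a singleton.\<close>
  proof (rule inj_on_inverseI[where
        g = "\<lambda>F. (\<Union>{A \<in> F. t \<in> A} - {t}, {A \<in> F. t \<notin> A})"])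
    fix x assume "x \<in> (SIGMA B:?S. ?Q B)"
    then obtain B G where x: "x = (B, G)" and B: "B \<subseteq> D - insert t T" and G: "G \<in> ?Q B"
      by blast
    have nt: "t \<notin> A" if "A \<in> G" for A
      using that G by (auto simp: transversal_packings_def packings_def)
    then have "{A \<in> insert (insert t B) G. t \<in> A} = {insert t B}"
        and "{A \<in> insert (insert t B) G. t \<notin> A} = G"
      by auto
    with B show "(\<Union>{A \<in> ?g x. t \<in> A} - {t}, {A \<in> ?g x. t \<notin> A}) = x"
      by (auto simp: x)
  qed
  have "card (SIGMA B:?S. ?Q B) \<le> card (transversal_packings D (insert t T) m)"
    using card_inj_on_le[OF inj sub] insert.prems finite_transversal_packings by blast
  moreover have "card (SIGMA B:?S. ?Q B) = (\<Sum>B\<in>?S. card (?Q B))"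
    using fS insert.prems by (intro card_SigmaI) (auto simp: finite_transversal_packings)
  ultimately have le: "(\<Sum>B\<in>?S. card (?Q B)) \<le> card (transversal_packings D (insert t T) m)"
    by simp
  have cardS: "card ?S = (card D - Suc ?l) choose (m - 1)"
    using insert.prems insert.hyps by (simp add: n_subsets card_Diff_subset)
  have "?l \<le> ?l * m"
    using assms(4) by simp
  moreover have "?l * m + m \<le> card D"
    using insert.prems insert.hyps by simp
  ultimately have "Suc ?l + (m - 1) \<le> card D"
    using assms(4) by linarith
  then have "m - 1 \<le> card D - Suc ?l" "card D - Suc ?l - (m - 1) = card D - m - ?l"
    using assms(4) by linarith+
  \<comment> \<open>The binomial coefficient counting the choices of \<open>B\<close> lifts the
    factorial in the induction hypothesis to the one in the goal.\<close>
  then have "fact (card D - Suc ?l) = card ?S * fact (card D - m - ?l) * fact (m - 1)"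
    using binomial_fact_lemma[of "m - 1" "card D - Suc ?l"] cardS
    by (simp add: algebra_simps)
  also have "\<dots> = (\<Sum>B\<in>?S. fact (card D - m - ?l)) * fact (m - 1)"
    by simp
  also have "\<dots> \<le> (\<Sum>B\<in>?S. card (?Q B) * ?K) * fact (m - 1)"
    by (intro mult_right_mono sum_mono IH) auto
  also have "\<dots> = (\<Sum>B\<in>?S. card (?Q B)) * (?K * fact (m - 1))"
    by (simp only: sum_distrib_right mult.assoc)
  also have "\<dots> \<le> card (transversal_packings D (insert t T) m) * (?K * fact (m - 1))"
    using le by (rule mult_right_mono) simp
  finally show ?case
    using insert.hyps by (simp add: algebra_simps)
qed

section \<open>Numerical estimates\<close>

lemma binomial_ge_self:
  assumes "0 < p" "p < N"
  shows "N \<le> N choose p"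
  using assms
proof (induction N arbitrary: p)
  case 0
  then show ?case by simp
next
  case (Suc N)
  obtain r where p: "p = Suc r"
    using Suc.prems gr0_conv_Suc by auto
  show ?case
  \<comment> \<open>For \<open>p = N\<close> the coefficient is \<open>Suc N\<close> itself.
    Otherwise Pascal's rule adds a term at least 1 to one bounded by induction.\<close>
  proof (cases "p = N")
    case True
    then show ?thesis
      using binomial_symmetric[of N "Suc N"] by simp
  next
    case False
    then have "N \<le> N choose p"
      using Suc by simp
    moreover have "N choose r \<ge> 1"
      using Suc.prems p by (simp add: Suc_le_eq)
    ultimately show ?thesis
      unfolding p binomial_Suc_Suc by linarith
  qed
qed

text \<open>The quotient of \<open>fact N\<close> by \<open>fact p ^ l * fact (N - l * p)\<close> is
  the product of the binomials \<open>(N - j * p) choose p\<close> for \<open>j < l\<close>. The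
  third hypothesis keeps every upper index at least \<open>c\<close>, so
  \<open>binomial_ge_self\<close> bounds each factor below by \<open>c\<close>.\<close>

lemma fact_ge_power_mult_fact:
  assumes "p > 0" "c > p" "c + l * p \<le> N + p"
  shows "fact p ^ l * fact (N - l * p) * c ^ l \<le> (fact N :: nat)"
  using assms(3)
proof (induction l)
  case 0
  then show ?case by simp
next
  case (Suc l)
  let ?M = "N - l * p"
  have M: "c \<le> ?M"
    using Suc.prems by simp
  with assms have "c \<le> ?M choose p"
    using binomial_ge_self[of p ?M] by simp
  then have "fact p * fact (?M - p) * c \<le> fact p * fact (?M - p) * (?M choose p)"
    by (rule mult_left_mono) simp
  also have "\<dots> = fact ?M"
    using M assms by (intro binomial_fact_lemma) simp
  finally have step: "fact p * fact (?M - p) * c \<le> (fact ?M :: nat)" .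
  have "fact p ^ Suc l * fact (N - Suc l * p) * c ^ Suc l
      = fact p ^ l * c ^ l * (fact p * fact (?M - p) * c)"
    by (simp add: algebra_simps)
  also have "\<dots> \<le> fact p ^ l * c ^ l * fact ?M"
    using step by (rule mult_left_mono) simp
  also have "\<dots> \<le> fact N"
    using Suc by (simp add: algebra_simps)
  finally show ?case .
qed

lemma card_packings_le_transversal_square:
  assumes "l \<ge> 1" "m \<ge> 2" "finite D" "card D \<ge> 2 * m * l" "T \<subseteq> D" "card T = l"
  shows "card (packings D l m) \<le> (card (transversal_packings D T m))\<^sup>2"
proof -
  define d n q where "d = card D" and "n = card (packings D l m)"
    and "q = card (transversal_packings D T m)"
  \<comment> \<open>After \<open>l - 1\<close> blocks have each taken \<open>m - 1\<close> points
    outside \<open>T\<close>, exactly \<open>c\<close> points remain to complete the last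
    block.\<close>
  define a r c :: nat where "a = fact (m - 1) ^ l" and "r = fact (d - l * m)"
    and "c = d - l - (l - 1) * (m - 1)"
  obtain p where p: "m = Suc p" "p > 0"
    using assms by (cases m) auto
  obtain s where s: "l = Suc s"
    using assms by (cases l) auto
  have d: "2 * (l * m) \<le> d"
    using assms by (simp add: d_def algebra_simps)
  have lm: "l * m = l + l * p" "l * p = p + s * p"
    by (simp_all add: p s)
  \<comment> \<open>Here \<open>c\<close> equals \<open>d - l * m + p\<close>, and
    \<open>l * m\<close> is at most half of \<open>d\<close>.\<close>
  have c: "c + l * p = d - l + p" "d \<le> 2 * c" "p < c"
    using d lm unfolding c_def s p by simp_all
  have pos: "a > 0" "r > 0"
    by (simp_all add: a_def r_def)
  have P: "n * (fact l * fact m ^ l * r) = fact d"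
    using card_packings[of D m l] assms d by (simp add: n_def d_def r_def)
  have Q: "fact (d - l) \<le> q * (a * r)"
    using card_transversal_packings_ge[of T D m] assms d finite_subset
    by (auto simp: q_def d_def a_def r_def)
  have "d - l - l * p = d - l * m"
    using lm by simp
  then have "c ^ l * (a * r) \<le> fact (d - l)"
    using fact_ge_power_mult_fact[of p c l "d - l"] c p by (simp add: a_def r_def algebra_simps)
  with Q have "c ^ l * (a * r) \<le> q * (a * r)"
    by (rule order_trans[rotated])
  then have cq: "c ^ l \<le> q"
    using pos by simp
  have "l \<le> d"
    using d lm by simp
  have "fact m ^ l = m ^ l * a"
    by (simp add: p a_def flip: power_mult_distrib)
  \<comment> \<open>\<open>n * m ^ l\<close> counts packings with one marked point per block, and
    \<open>d choose l\<close> the possible sets of marked points. The comparison is made through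
    factorials, with the common factor \<open>fact l * a * r\<close> cancelled at the end.\<close>
  then have "(n * m ^ l) * (fact l * a * r) = fact d"
    using P by (simp add: algebra_simps)
  also have "\<dots> = (d choose l) * fact l * fact (d - l)"
    using binomial_fact_lemma[OF \<open>l \<le> d\<close>] by (simp add: algebra_simps)
  also have "\<dots> \<le> (d choose l) * fact l * (q * (a * r))"
    using Q by (rule mult_left_mono) simp
  also have "\<dots> = ((d choose l) * q) * (fact l * a * r)"
    by (simp add: algebra_simps)
  finally have "n * m ^ l \<le> (d choose l) * q"
    using pos by simp
  also have "\<dots> \<le> (m ^ l * q) * q"
  proof (rule mult_right_mono)
    \<comment> \<open>The hypothesis \<open>m \<ge> 2\<close> absorbs the factor 2 of
      \<open>d \<le> 2 * c\<close>, so that \<open>m ^ l\<close> cancels.\<close>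
    have "2 * c \<le> m * c"
      using assms by simp
    have "d choose l \<le> d ^ l"
      using \<open>l \<le> d\<close> by (rule binomial_le_pow)
    also have "\<dots> \<le> (m * c) ^ l"
      using c(2) \<open>2 * c \<le> m * c\<close> by (intro power_mono) linarith+
    also have "\<dots> \<le> m ^ l * q"
      using cq by (simp add: power_mult_distrib)
    finally show "d choose l \<le> m ^ l * q" .
  qed simp
  also have "\<dots> = q\<^sup>2 * m ^ l"
    by (simp add: power2_eq_square)
  finally show ?thesis
    using assms by (simp add: n_def q_def)
qed

section \<open>Hypotheses as images of packings\<close>

definition hyp_of_packing :: "nat \<Rightarrow> nat set set \<Rightarrow> (nat \<Rightarrow> bool) \<Rightarrow> bool" where
  "hyp_of_packing d F = (\<lambda>x\<in>cube d. \<forall>A\<in>F. \<exists>i\<in>A. x i)"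

text \<open>As \<open>m > 0\<close>, blocks are nonempty, so a disjoint family is injective and its
  image has exactly \<open>l\<close> blocks; conversely, any enumeration of a packing is such a
  family. Unordered packings forget the order of the disjunctions, which makes the parametrization
  injective.\<close>

lemma hypotheses_eq_image:
  assumes "m > 0"
  shows "hypotheses d l m = hyp_of_packing d ` packings {1..d} l m"
proof (intro equalityI subsetI)
  fix h assume "h \<in> hypotheses d l m"
  then obtain A where h: "h = conj_of_disj d l A"
    and A: "\<forall>j\<in>{1..l}. A j \<subseteq> {1..d} \<and> card (A j) = m" "disjoint_family_on A {1..l}"
    by (auto simp: hypotheses_def)
  have "A j \<noteq> {}" if "j \<in> {1..l}" for j
    using A that assms by fastforce
  then have "inj_on A {1..l}"
    using A(2) unfolding inj_on_def disjoint_family_on_def by (metis inf.idem)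
  then have "card (A ` {1..l}) = l"
    by (simp add: card_image)
  moreover have "disjoint (A ` {1..l})"
    using A(2) by (rule disjoint_family_on_disjoint_image)
  ultimately have "A ` {1..l} \<in> packings {1..d} l m"
    using A by (auto simp: packings_def)
  moreover have "h = hyp_of_packing d (A ` {1..l})"
    by (simp add: h conj_of_disj_def hyp_of_packing_def)
  ultimately show "h \<in> hyp_of_packing d ` packings {1..d} l m"
    by blast
next
  fix h assume "h \<in> hyp_of_packing d ` packings {1..d} l m"
  then obtain F where h: "h = hyp_of_packing d F" and F: "F \<in> packings {1..d} l m"
    by blast
  have "card F = card {1..l}" "finite F"
    using F finite_packing[OF _ F] by (simp_all add: packings_def)
  then obtain A where A: "bij_betw A {1..l} F"
    by (metis finite_same_card_bij finite_atLeastAtMost)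
  then have img: "A ` {1..l} = F"
    by (rule bij_betw_imp_surj_on)
  have "h = conj_of_disj d l A"
    unfolding h img[symmetric] by (simp add: conj_of_disj_def hyp_of_packing_def)
  moreover have "disjoint_family_on A {1..l}"
    using A F disjoint_image_disjoint_family_on[of A "{1..l}"]
    by (simp add: bij_betw_def packings_def)
  moreover have "A j \<subseteq> {1..d} \<and> card (A j) = m" if "j \<in> {1..l}" for j
    using F img that unfolding packings_def by blast
  ultimately show "h \<in> hypotheses d l m"
    unfolding hypotheses_def by blast
qed

text \<open>The blocks of a packing are recovered from its hypothesis as the \<open>m\<close>-sets \<open>B\<close> such that the
  hypothesis is false on the complement of \<open>B\<close>.\<close>

lemma inj_on_hyp_of_packing: "inj_on (hyp_of_packing d) (packings {1..d} l m)"
proof (rule inj_on_inverseI[where g = "\<lambda>h. {B. B \<subseteq> {1..d} \<and> card B = m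
      \<and> \<not> h (\<lambda>i\<in>{1..d}. i \<notin> B)}"])
  fix F assume F: "F \<in> packings {1..d} l m"
  have false_iff: "\<not> hyp_of_packing d F (\<lambda>i\<in>{1..d}. i \<notin> B) \<longleftrightarrow> (\<exists>A\<in>F. A \<subseteq> B)" for B
  proof -
    have "(\<lambda>i\<in>{1..d}. i \<notin> B) \<in> cube d"
      unfolding cube_def by simp
    then have "hyp_of_packing d F (\<lambda>i\<in>{1..d}. i \<notin> B)
        \<longleftrightarrow> (\<forall>A\<in>F. \<exists>i\<in>A. (\<lambda>i\<in>{1..d}. i \<notin> B) i)"
      unfolding hyp_of_packing_def by (rule restrict_apply')
    moreover have "(\<lambda>i\<in>{1..d}. i \<notin> B) i \<longleftrightarrow> i \<notin> B" if "A \<in> F" "i \<in> A" for A i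
      using F that unfolding packings_def by (intro restrict_apply') blast
    ultimately show ?thesis
      by blast
  qed
  \<comment> \<open>Equal finite cardinality turns inclusion of a block in an \<open>m\<close>-set
    into equality.\<close>
  have sub_eq: "A = B" if "A \<in> F" "A \<subseteq> B" "B \<subseteq> {1..d}" "card B = m" for A B
    using that F by (intro card_subset_eq) (auto simp: packings_def intro: finite_subset)
  show "{B. B \<subseteq> {1..d} \<and> card B = m \<and> \<not> hyp_of_packing d F (\<lambda>i\<in>{1..d}. i \<notin> B)} = F"
    unfolding false_iff using F sub_eq by (auto simp: packings_def)
qed

text \<open>A true variable chosen from each block gives \<open>l\<close> distinct ones of
  \<open>x\<close>, because the blocks are disjoint.\<close>

lemma hyp_of_packing_false:
  assumes "F \<in> packings {1..d} l m" "card {i\<in>{1..d}. x i} < l" "x \<in> cube d"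
  shows "\<not> hyp_of_packing d F x"
proof
  assume "hyp_of_packing d F x"
  then have "\<forall>A\<in>F. \<exists>i. i \<in> A \<and> x i"
    using assms(3) by (auto simp: hyp_of_packing_def)
  then obtain g where g: "\<And>A. A \<in> F \<Longrightarrow> g A \<in> A \<and> x (g A)"
    by metis
  have "disjoint F"
    using assms(1) by (simp add: packings_def)
  then have "inj_on g F"
    using g by (intro inj_onI) (metis disjointD disjoint_iff)
  moreover have "g ` F \<subseteq> {i\<in>{1..d}. x i}"
    using g assms(1) unfolding packings_def by blast
  ultimately have "card F \<le> card {i\<in>{1..d}. x i}"
    by (intro card_inj_on_le) auto
  with assms show False
    by (simp add: packings_def)
qed

section \<open>From connectivity to a lower bound on \<open>k\<close>\<close>

lemma rtrancl_crossing:
  assumes "(x, y) \<in> R\<^sup>*" "P x" "\<not> P y"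
  obtains u v where "(u, v) \<in> R" "P u" "\<not> P v"
  using assms by (induction rule: rtrancl_induct) blast+

text \<open>On an edge from a test \<open>x\<close> with fewer than \<open>l\<close> ones to a test
  \<open>y\<close> with at least \<open>l\<close>, every packing transversal to \<open>l\<close>
  ones of \<open>y\<close> separates \<open>x\<close> from \<open>y\<close>. Injectivity of
  \<open>hyp_of_packing\<close> turns this inclusion into a count.\<close>

lemma neighborly_imp_transversal_le:
  assumes "neighborly (hypotheses d l m) (cube d) k" "1 \<le> l" "l \<le> d" "m > 0"
  obtains T where "T \<subseteq> {1..d}" "card T = l" "card (transversal_packings {1..d} T m) \<le> k"
proof -
  let ?H = "hypotheses d l m"
  let ?one = "\<lambda>x. {i\<in>{1..d}. x i} :: nat set"
  let ?P = "\<lambda>x. card (?one x) < l"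
  have "(\<lambda>i\<in>{1..d}. False) \<in> cube d" "(\<lambda>i\<in>{1..d}. True) \<in> cube d"
    by (auto simp: cube_def)
  then have path: "(\<lambda>i\<in>{1..d}. False, \<lambda>i\<in>{1..d}. True) \<in> (neighbor_edges ?H (cube d) k)\<^sup>*"
    using assms(1) by (simp add: neighborly_def)
  have ends: "?one (\<lambda>i\<in>{1..d}. False) = {}" "?one (\<lambda>i\<in>{1..d}. True) = {1..d}"
    by auto
  obtain x y where xy: "(x, y) \<in> neighbor_edges ?H (cube d) k" "?P x" "\<not> ?P y"
  proof (rule rtrancl_crossing[OF path, of ?P])
    show "?P (\<lambda>i\<in>{1..d}. False)" "\<not> ?P (\<lambda>i\<in>{1..d}. True)"
      unfolding ends using assms by simp_all
  qed
  \<comment> \<open>An edge may change many coordinates at once, so \<open>y\<close> can have more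
    than \<open>l\<close> ones; any \<open>l\<close> of them serve.\<close>
  obtain T where T: "T \<subseteq> ?one y" "card T = l"
    using xy(3) by (meson obtain_subset_with_card_n not_less)
  have xycube: "x \<in> cube d" "y \<in> cube d"
    using xy(1) by (auto simp: neighbor_edges_def)
  have "hyp_of_packing d ` transversal_packings {1..d} T m \<subseteq> Delta ?H x y"
  proof clarify
    fix F assume F: "F \<in> transversal_packings {1..d} T m"
    then have Fp: "F \<in> packings {1..d} l m"
      using T by (simp add: transversal_packings_def)
    have "hyp_of_packing d F y"
    proof -
      have "\<exists>i\<in>A. y i" if "A \<in> F" for A
        using that F T(1) unfolding transversal_packings_def by blast
      then show ?thesis
        using xycube by (simp add: hyp_of_packing_def)
    qed
    then show "hyp_of_packing d F \<in> Delta ?H x y"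
      using Fp hyp_of_packing_false[OF Fp xy(2) xycube(1)]
      by (simp add: Delta_def hypotheses_eq_image[OF assms(4)])
  qed
  then have "card (hyp_of_packing d ` transversal_packings {1..d} T m)
      \<le> card (Delta ?H x y \<union> Delta ?H y x)"
    using xy(1) by (intro card_mono) (auto simp: neighbor_edges_def)
  also have "\<dots> \<le> k"
    using xy(1) by (simp add: neighbor_edges_def)
  also have "card (hyp_of_packing d ` transversal_packings {1..d} T m)
      = card (transversal_packings {1..d} T m)"
    using T by (intro card_image inj_on_subset[OF inj_on_hyp_of_packing[of d l m]])
      (auto simp: transversal_packings_def)
  finally show ?thesis
    using T by (intro that[of T]) auto
qed

theorem mainTheorem9:
  fixes l m d :: nat
  assumes "l \<ge> 1" and "m \<ge> 2" and "d \<ge> 2 * m * l"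
  shows "real (card (hypotheses d l m)) =
           1 / fact l * (fact d / ((fact m) ^ l * fact (d - l * m)))
       \<and> (\<forall>k::nat. neighborly (hypotheses d l m) (cube d) k \<longrightarrow>
            real k \<ge> sqrt (real (card (hypotheses d l m))))"
proof (intro conjI allI impI)
  have m: "m > 0"
    using assms by simp
  have d: "l * m \<le> d"
    using assms by (simp add: algebra_simps)
  have "l \<le> l * m"
    using m by simp
  with d have "l \<le> d"
    by linarith
  have n: "card (hypotheses d l m) = card (packings {1..d} l m)"
    unfolding hypotheses_eq_image[OF m] by (rule card_image[OF inj_on_hyp_of_packing])
  have "card (packings {1..d} l m) * (fact l * fact m ^ l * fact (d - l * m)) = fact d"
    using card_packings[of "{1..d}" m l] m d by simp
  then have "real (card (packings {1..d} l m)) * (fact l * fact m ^ l * fact (d - l * m)) = fact d"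
    by (metis of_nat_mult of_nat_fact of_nat_power)
  then show "real (card (hypotheses d l m))
      = 1 / fact l * (fact d / ((fact m) ^ l * fact (d - l * m)))"
    by (simp add: n field_simps)
  fix k assume "neighborly (hypotheses d l m) (cube d) k"
  then obtain T where T: "T \<subseteq> {1..d}" "card T = l" "card (transversal_packings {1..d} T m) \<le> k"
    using neighborly_imp_transversal_le assms(1) \<open>l \<le> d\<close> m by blast
  have "card (packings {1..d} l m) \<le> (card (transversal_packings {1..d} T m))\<^sup>2"
    using assms T by (intro card_packings_le_transversal_square) auto
  also have "\<dots> \<le> k\<^sup>2"
    using T(3) by (rule power_mono) simp
  finally have "real (card (hypotheses d l m)) \<le> (real k)\<^sup>2"
    by (simp add: n flip: of_nat_power)
  then show "sqrt (real (card (hypotheses d l m))) \<le> real k"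
    by (rule real_le_lsqrt[rotated]) simp
qed

end
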